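(* Let $k$ be a field of characteristic $0$, let $J$ be a vector space over $k$, and let $\mu : \mathrm{Sym}^2 J \to J$ be a Jordan product on $J$. Let $\delta_\mu : C^1(J)\to C^2(J)$ be the equivalence differential and $d_\mu : C^2(J)\to C^3(J)$ the linearized Jordan differential. Then $$d_\mu\circ\delta_\mu = 0,$$ that is, $d_\mu(\delta_\mu D)=0$ for every $k$-linear endomorphism $D$ of $J$.
   Context: Let $k$ be a field of characteristic $0$ and $J$ a $k$-vector space. Jordan product: a commutative (symmetric) bilinear map $\mu:\mathrm{Sym}^2 J\to J$, written $x\circ y:=\mu(x,y)$ with $x^2:=x\circ x$, is a Jordan product if $(x^2\circ y)\circ x = x^2\circ(y\circ x)$ for all $x,y\in J$. Jordan defect: for any commutative bilinear map $\mu:\mathrm{Sym}^2J\to J$, the Jordan defect $J(\mu):J^{\otimes 4}\to J$ is the multilinear map, symmetric in $a,c,d$, given by $$\begin{aligned} J(\mu)(a,c,d;b) :={}& \mu(\mu(\mu(a,c),b),d)+\mu(\mu(\mu(c,d),b),a)+\mu(\mu(\mu(d,a),b),c)\\ &-\mu(\mu(a,c),\mu(b,d))-\mu(\mu(c,d),\mu(b,a))-\mu(\mu(d,a),\mu(b,c)). \end{aligned}$$ Cochain spaces: $C^1(J)=\mathrm{End}(J)$ is the space of $k$-linear endomorphisms of $J$; $C^2(J)$ is the space of symmetric bilinear maps $J\times J\to J$ (for finite-dimensional $J$, $\mathrm{Sym}^2(J^\vee)\otimes J$); $C^3(J)$ is the space of quadrilinear maps $(a,c,d;b)\mapsto J$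 symmetric in the three variables $a,c,d$ (for finite-dimensional $J$, $\mathrm{Sym}^3(J^\vee)\otimes J^\vee\otimes J$). Equivalence differential: for $D\in C^1(J)$, $\delta_\mu D\in C^2(J)$ is $$(\delta_\mu D)(x,y):=D(\mu(x,y))-\mu(Dx,y)-\mu(x,Dy).$$ Linearized Jordan differential: for $\varphi\in C^2(J)$, $$d_\mu\varphi:=\left.\frac{d}{dt}\right|_{t=0}J(\mu+t\varphi)\in C^3(J),$$ that is, the coefficient of $t$ in $J(\mu+t\varphi)$, which is a polynomial in $t$ of degree at most $3$ with coefficients in $C^3(J)$. *)

theory Defs
  imports Complex_Main
begin

text \<open>The vector space \<open>J\<close> is a type \<open>'v\<close> of class \<open>ab_group_add\<close> together with a scalar
  multiplication \<open>s\<close> satisfying \<open>vector_space s\<close>. Elements \<open>(a,c,d;b) \<mapsto> \<psi>(a,c,d;b)\<close> of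
  \<open>C\<^sup>3(J)\<close> are curried in the order \<open>\<psi> a c d b\<close>.\<close>

definition cochain1 :: "('k::field \<Rightarrow> 'v::ab_group_add \<Rightarrow> 'v) \<Rightarrow> ('v \<Rightarrow> 'v) set" where
  "cochain1 s = {D. Vector_Spaces.linear s s D}"

definition cochain2 :: "('k::field \<Rightarrow> 'v::ab_group_add \<Rightarrow> 'v) \<Rightarrow> ('v \<Rightarrow> 'v \<Rightarrow> 'v) set" where
  "cochain2 s = {\<phi>. (\<forall>x y. \<phi> x y = \<phi> y x)
     \<and> (\<forall>y. Vector_Spaces.linear s s (\<lambda>x. \<phi> x y))
     \<and> (\<forall>x. Vector_Spaces.linear s s (\<lambda>y. \<phi> x y))}"

definition cochain3 ::
  "('k::field \<Rightarrow> 'v::ab_group_add \<Rightarrow> 'v) \<Rightarrow> ('v \<Rightarrow> 'v \<Rightarrow> 'v \<Rightarrow> 'v \<Rightarrow> 'v) set" where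
  "cochain3 s = {\<psi>. (\<forall>a c d b. \<psi> a c d b = \<psi> c a d b) \<and> (\<forall>a c d b. \<psi> a c d b = \<psi> a d c b)
     \<and> (\<forall>c d b. Vector_Spaces.linear s s (\<lambda>a. \<psi> a c d b))
     \<and> (\<forall>a d b. Vector_Spaces.linear s s (\<lambda>c. \<psi> a c d b))
     \<and> (\<forall>a c b. Vector_Spaces.linear s s (\<lambda>d. \<psi> a c d b))
     \<and> (\<forall>a c d. Vector_Spaces.linear s s (\<lambda>b. \<psi> a c d b))}"

definition jordan_product ::
  "('k::field \<Rightarrow> 'v::ab_group_add \<Rightarrow> 'v) \<Rightarrow> ('v \<Rightarrow> 'v \<Rightarrow> 'v) \<Rightarrow> bool" where
  "jordan_product s \<mu> \<longleftrightarrow> \<mu> \<in> cochain2 s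
     \<and> (\<forall>x y. \<mu> (\<mu> (\<mu> x x) y) x = \<mu> (\<mu> x x) (\<mu> y x))"

definition jordan_defect ::
  "('v::ab_group_add \<Rightarrow> 'v \<Rightarrow> 'v) \<Rightarrow> 'v \<Rightarrow> 'v \<Rightarrow> 'v \<Rightarrow> 'v \<Rightarrow> 'v" where
  "jordan_defect \<mu> a c d b =
     \<mu> (\<mu> (\<mu> a c) b) d + \<mu> (\<mu> (\<mu> c d) b) a + \<mu> (\<mu> (\<mu> d a) b) c
     - \<mu> (\<mu> a c) (\<mu> b d) - \<mu> (\<mu> c d) (\<mu> b a) - \<mu> (\<mu> d a) (\<mu> b c)"

definition equiv_diff ::
  "('v::ab_group_add \<Rightarrow> 'v \<Rightarrow> 'v) \<Rightarrow> ('v \<Rightarrow> 'v) \<Rightarrow> 'v \<Rightarrow> 'v \<Rightarrow> 'v" where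
  "equiv_diff \<mu> D x y = D (\<mu> x y) - \<mu> (D x) y - \<mu> x (D y)"

text \<open>\<open>is_linear_coeff s \<mu> \<phi> \<psi>\<close>: \<open>J(\<mu> + t\<phi>)\<close> is a polynomial in \<open>t\<close> of degree at most 3 with
  coefficients in \<open>C\<^sup>3(J)\<close>, and \<open>\<psi>\<close> is its coefficient of \<open>t\<close>. Existence and uniqueness of \<open>\<psi>\<close>
  in characteristic 0 are proved below (\<open>ex1_linear_coeff\<close>).\<close>

definition is_linear_coeff ::
  "('k::field \<Rightarrow> 'v::ab_group_add \<Rightarrow> 'v) \<Rightarrow> ('v \<Rightarrow> 'v \<Rightarrow> 'v) \<Rightarrow> ('v \<Rightarrow> 'v \<Rightarrow> 'v)
     \<Rightarrow> ('v \<Rightarrow> 'v \<Rightarrow> 'v \<Rightarrow> 'v \<Rightarrow> 'v) \<Rightarrow> bool" where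
  "is_linear_coeff s \<mu> \<phi> \<psi> \<longleftrightarrow> \<psi> \<in> cochain3 s \<and>
     (\<exists>\<psi>0 \<in> cochain3 s. \<exists>\<psi>2 \<in> cochain3 s. \<exists>\<psi>3 \<in> cochain3 s. \<forall>t a c d b.
        jordan_defect (\<lambda>x y. \<mu> x y + s t (\<phi> x y)) a c d b =
          \<psi>0 a c d b + s t (\<psi> a c d b) + s (t ^ 2) (\<psi>2 a c d b) + s (t ^ 3) (\<psi>3 a c d b))"

definition lin_jordan_diff ::
  "('k::field \<Rightarrow> 'v::ab_group_add \<Rightarrow> 'v) \<Rightarrow> ('v \<Rightarrow> 'v \<Rightarrow> 'v) \<Rightarrow> ('v \<Rightarrow> 'v \<Rightarrow> 'v)
     \<Rightarrow> 'v \<Rightarrow> 'v \<Rightarrow> 'v \<Rightarrow> 'v \<Rightarrow> 'v" where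
  "lin_jordan_diff s \<mu> \<phi> = (THE \<psi>. is_linear_coeff s \<mu> \<phi> \<psi>)"

lemma linear_iff_add_scale:
  assumes "vector_space s"
  shows "Vector_Spaces.linear s s f \<longleftrightarrow> (\<forall>x y. f (x + y) = f x + f y) \<and> (\<forall>r x. f (s r x) = s r (f x))"
  using assms unfolding Vector_Spaces.linear_def module_hom_iff module_iff_vector_space by auto

lemma cochain2D:
  assumes "vector_space s" "\<phi> \<in> cochain2 s"
  shows "\<phi> x y = \<phi> y x" "\<phi> (x + x') y = \<phi> x y + \<phi> x' y" "\<phi> x (y + y') = \<phi> x y + \<phi> x y'"
    "\<phi> (s r x) y = s r (\<phi> x y)" "\<phi> x (s r y) = s r (\<phi> x y)"
  using assms(2) unfolding cochain2_def mem_Collect_eq linear_iff_add_scale[OF assms(1)] by blast+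

lemma equiv_diff_mem:
  assumes vs: "vector_space s" and mu: "\<mu> \<in> cochain2 s" and D: "D \<in> cochain1 s"
  shows "equiv_diff \<mu> D \<in> cochain2 s"
proof -
  interpret vector_space s by fact
  note m = cochain2D[OF vs mu]
  have D': "D (x + y) = D x + D y" "D (s r x) = s r (D x)" for x y r
    using D unfolding cochain1_def mem_Collect_eq linear_iff_add_scale[OF vs] by blast+
  have "equiv_diff \<mu> D x y = equiv_diff \<mu> D y x" for x y
    unfolding equiv_diff_def using m(1)[of x y] m(1)[of "D x" y] m(1)[of x "D y"]
    by (simp add: algebra_simps)
  moreover have "equiv_diff \<mu> D (x + x') y = equiv_diff \<mu> D x y + equiv_diff \<mu> D x' y"
    "equiv_diff \<mu> D x (y + y') = equiv_diff \<mu> D x y + equiv_diff \<mu> D x y'"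
    "equiv_diff \<mu> D (s r x) y = s r (equiv_diff \<mu> D x y)"
    "equiv_diff \<mu> D x (s r y) = s r (equiv_diff \<mu> D x y)" for x x' y y' r
    unfolding equiv_diff_def by (simp_all add: m(2-5) D' algebra_simps)
  ultimately show ?thesis
    unfolding cochain2_def mem_Collect_eq linear_iff_add_scale[OF vs] by blast
qed

text \<open>Polarization of the Jordan defect: \<open>J(\<mu>) = T(\<mu>,\<mu>,\<mu>)\<close> with \<open>T\<close> additive in each argument.\<close>

definition polar_defect ::
  "('v::ab_group_add \<Rightarrow> 'v \<Rightarrow> 'v) \<Rightarrow> ('v \<Rightarrow> 'v \<Rightarrow> 'v) \<Rightarrow> ('v \<Rightarrow> 'v \<Rightarrow> 'v)
     \<Rightarrow> 'v \<Rightarrow> 'v \<Rightarrow> 'v \<Rightarrow> 'v \<Rightarrow> 'v" where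
  "polar_defect f g h a c d b =
     h (g (f a c) b) d + h (g (f c d) b) a + h (g (f d a) b) c
     - h (f a c) (g b d) - h (f c d) (g b a) - h (f d a) (g b c)"

lemma polar_defect_mem:
  assumes vs: "vector_space s" and f: "f \<in> cochain2 s" and g: "g \<in> cochain2 s" and h: "h \<in> cochain2 s"
  shows "polar_defect f g h \<in> cochain3 s"
proof -
  interpret vector_space s by fact
  note F = cochain2D[OF vs f] and G = cochain2D[OF vs g] and H = cochain2D[OF vs h]
  have sym: "polar_defect f g h a c d b = polar_defect f g h c a d b"
    "polar_defect f g h a c d b = polar_defect f g h a d c b" for a c d b
    unfolding polar_defect_def using F(1)[of a c] F(1)[of c d] F(1)[of d a]
    by (simp_all add: algebra_simps)
  have lin:
    "polar_defect f g h (a + a') c d b = polar_defect f g h a c d b + polar_defect f g h a' c d b"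
    "polar_defect f g h a (c + c') d b = polar_defect f g h a c d b + polar_defect f g h a c' d b"
    "polar_defect f g h a c (d + d') b = polar_defect f g h a c d b + polar_defect f g h a c d' b"
    "polar_defect f g h a c d (b + b') = polar_defect f g h a c d b + polar_defect f g h a c d b'"
    "polar_defect f g h (s r a) c d b = s r (polar_defect f g h a c d b)"
    "polar_defect f g h a (s r c) d b = s r (polar_defect f g h a c d b)"
    "polar_defect f g h a c (s r d) b = s r (polar_defect f g h a c d b)"
    "polar_defect f g h a c d (s r b) = s r (polar_defect f g h a c d b)"
    for a a' c c' d d' b b' r
    unfolding polar_defect_def by (simp_all add: F(2-5) G(2-5) H(2-5) algebra_simps)
  show ?thesis
    unfolding cochain3_def mem_Collect_eq linear_iff_add_scale[OF vs] by (intro conjI allI sym lin)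
qed

lemma cochain3_add:
  assumes vs: "vector_space s" and "\<psi> \<in> cochain3 s" "\<chi> \<in> cochain3 s"
  shows "(\<lambda>a c d b. \<psi> a c d b + \<chi> a c d b) \<in> cochain3 s"
proof -
  interpret vector_space s by fact
  show ?thesis
    using assms(2,3) unfolding cochain3_def mem_Collect_eq linear_iff_add_scale[OF vs]
    by (simp add: algebra_simps)
qed

lemma is_linear_coeff_explicit:
  assumes vs: "vector_space s" and mu: "\<mu> \<in> cochain2 s" and phi: "\<phi> \<in> cochain2 s"
  shows "is_linear_coeff s \<mu> \<phi> (\<lambda>a c d b.
    polar_defect \<phi> \<mu> \<mu> a c d b + polar_defect \<mu> \<phi> \<mu> a c d b + polar_defect \<mu> \<mu> \<phi> a c d b)"
    (is "is_linear_coeff _ _ _ ?p1")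
proof -
  interpret vector_space s by fact
  note M = cochain2D(2-5)[OF vs mu] and P = cochain2D(2-5)[OF vs phi]
  let ?p0 = "polar_defect \<mu> \<mu> \<mu>" and ?p3 = "polar_defect \<phi> \<phi> \<phi>"
  let ?p2 = "\<lambda>a c d b.
    polar_defect \<mu> \<phi> \<phi> a c d b + polar_defect \<phi> \<mu> \<phi> a c d b + polar_defect \<phi> \<phi> \<mu> a c d b"
  have mem: "?p0 \<in> cochain3 s" "?p1 \<in> cochain3 s" "?p2 \<in> cochain3 s" "?p3 \<in> cochain3 s"
    by (intro cochain3_add polar_defect_mem vs mu phi)+
  have expand: "jordan_defect (\<lambda>x y. \<mu> x y + s t (\<phi> x y)) a c d b =
      ?p0 a c d b + s t (?p1 a c d b) + s (t ^ 2) (?p2 a c d b) + s (t ^ 3) (?p3 a c d b)"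
    for t a c d b
    unfolding jordan_defect_def polar_defect_def
    by (simp add: M P algebra_simps power2_eq_square power3_eq_cube)
  show ?thesis
    unfolding is_linear_coeff_def
    by (intro conjI mem(2) bexI[OF _ mem(1)] bexI[OF _ mem(3)] bexI[OF _ mem(4)] allI expand)
qed

lemma linear_coeff_unique:
  fixes s :: "'k::field_char_0 \<Rightarrow> 'v::ab_group_add \<Rightarrow> 'v"
  assumes vs: "vector_space s"
    and eq: "\<And>t. p0 + s t p1 + s (t ^ 2) p2 + s (t ^ 3) p3 = q0 + s t q1 + s (t ^ 2) q2 + s (t ^ 3) q3"
  shows "p1 = q1"
proof -
  interpret vector_space s by fact
  define e0 e1 e2 e3 where e: "e0 = p0 - q0" "e1 = p1 - q1" "e2 = p2 - q2" "e3 = p3 - q3"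
  have z: "e0 + s t e1 + s (t ^ 2) e2 + s (t ^ 3) e3 = 0" for t
    using eq[of t] unfolding e by (simp add: algebra_simps)
  have z0: "e0 = 0" using z[of 0] by simp
  have z1: "e1 + e2 + e3 = 0" using z[of 1] z0 by simp
  have z2: "e2 - e1 - e3 = 0" using z[of "-1"] z0 by (simp add: algebra_simps)
  have "s 2 e2 = e2 + e2" using scale_left_distrib[of 1 1 e2] by simp
  also have "\<dots> = (e1 + e2 + e3) + (e2 - e1 - e3)" by (simp add: algebra_simps)
  finally have e2: "e2 = 0" using z1 z2 by simp
  have e3: "e3 = - e1" using z1 e2 by (simp add: eq_neg_iff_add_eq_0 add.commute)
  have "s 2 e1 + s (2 ^ 3) e3 = 0" using z[of 2] z0 e2 by simp
  then have "s (2 - 2 ^ 3) e1 = 0" unfolding e3 by (simp add: scale_left_diff_distrib del: power_numeral)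
  then have "e1 = 0" by simp
  then show ?thesis unfolding e by simp
qed

lemma ex1_linear_coeff:
  fixes s :: "'k::field_char_0 \<Rightarrow> 'v::ab_group_add \<Rightarrow> 'v"
  assumes vs: "vector_space s" and mu: "\<mu> \<in> cochain2 s" and phi: "\<phi> \<in> cochain2 s"
  shows "\<exists>!\<psi>. is_linear_coeff s \<mu> \<phi> \<psi>"
proof (rule ex_ex1I)
  show "\<exists>\<psi>. is_linear_coeff s \<mu> \<phi> \<psi>" using is_linear_coeff_explicit[OF assms] by blast
next
  fix \<psi> \<chi> assume "is_linear_coeff s \<mu> \<phi> \<psi>" "is_linear_coeff s \<mu> \<phi> \<chi>"
  then obtain p0 p2 p3 q0 q2 q3 where
    p: "\<And>t a c d b. jordan_defect (\<lambda>x y. \<mu> x y + s t (\<phi> x y)) a c d b =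
          p0 a c d b + s t (\<psi> a c d b) + s (t ^ 2) (p2 a c d b) + s (t ^ 3) (p3 a c d b)" and
    q: "\<And>t a c d b. jordan_defect (\<lambda>x y. \<mu> x y + s t (\<phi> x y)) a c d b =
          q0 a c d b + s t (\<chi> a c d b) + s (t ^ 2) (q2 a c d b) + s (t ^ 3) (q3 a c d b)"
    unfolding is_linear_coeff_def by blast
  have "\<psi> a c d b = \<chi> a c d b" for a c d b
    by (rule linear_coeff_unique[OF vs]) (rule trans[OF p[symmetric] q])
  then show "\<psi> = \<chi>" by (intro ext)
qed

lemma is_linear_coeff_lin_jordan_diff:
  fixes s :: "'k::field_char_0 \<Rightarrow> 'v::ab_group_add \<Rightarrow> 'v"
  assumes "vector_space s" "\<mu> \<in> cochain2 s" "\<phi> \<in> cochain2 s"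
  shows "is_linear_coeff s \<mu> \<phi> (lin_jordan_diff s \<mu> \<phi>)"
  unfolding lin_jordan_diff_def by (rule theI'[OF ex1_linear_coeff[OF assms]])

lemma lin_jordan_diff_mem:
  fixes s :: "'k::field_char_0 \<Rightarrow> 'v::ab_group_add \<Rightarrow> 'v"
  assumes "vector_space s" "\<mu> \<in> cochain2 s" "\<phi> \<in> cochain2 s"
  shows "lin_jordan_diff s \<mu> \<phi> \<in> cochain3 s"
  using is_linear_coeff_lin_jordan_diff[OF assms] unfolding is_linear_coeff_def by blast

end

theory Submission
  imports Defs
begin

text \<open>The Jordan defect is natural, so \<open>J(\<mu>)\<close> transforms under \<open>1 + tD\<close> just as \<open>\<mu>\<close> does; to first
  order in \<open>t\<close> this says that \<open>d\<^sub>\<mu>(\<delta>\<^sub>\<mu> D)\<close> is the derivation-defect of \<open>D\<close> with respect to the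
  quadrilinear operation \<open>J(\<mu>)\<close>. In characteristic 0, polarizing the Jordan identity gives
  \<open>J(\<mu>) = 0\<close>, and the right-hand side vanishes.\<close>

text \<open>Polarization: the diagonal of a symmetric trilinear map determines 3! times the map, and
  6 is invertible in characteristic 0.\<close>

lemma cochain3_eq_0_if_diagonal_eq_0:
  fixes s :: "'k::field_char_0 \<Rightarrow> 'v::ab_group_add \<Rightarrow> 'v"
  assumes vs: "vector_space s" and psi: "\<psi> \<in> cochain3 s"
    and diag: "\<And>x b. \<psi> x x x b = 0"
  shows "\<psi> a c d b = 0"
proof -
  interpret vector_space s by fact
  have sym: "\<psi> x y z b = \<psi> y x z b" "\<psi> x y z b = \<psi> x z y b" for x y z
    using psi unfolding cochain3_def by blast+
  have lin: "Vector_Spaces.linear s s (\<lambda>x. \<psi> x y z b)"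
    "Vector_Spaces.linear s s (\<lambda>x. \<psi> y x z b)"
    "Vector_Spaces.linear s s (\<lambda>x. \<psi> y z x b)" for y z
    using psi unfolding cochain3_def by blast+
  note add = lin[unfolded linear_iff_add_scale[OF vs], THEN conjunct1, rule_format]
  let ?p = "\<psi> a c d b"
  have perm: "\<psi> a d c b = ?p" "\<psi> c a d b = ?p" "\<psi> c d a b = ?p" "\<psi> d a c b = ?p" "\<psi> d c a b = ?p"
    using sym(1)[of a c d] sym(2)[of a c d] sym(2)[of c a d] sym(1)[of a d c] sym(1)[of c d a]
    by simp_all
  \<comment> \<open>Inclusion-exclusion over the nonempty subsets of \<open>a\<close>,
    \<open>c\<close>, \<open>d\<close> leaves the six terms with distinct arguments, all equal to
    \<open>?p\<close> by symmetry.\<close>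
  have "?p + ?p + ?p + ?p + ?p + ?p =
      \<psi> (a + c + d) (a + c + d) (a + c + d) b
      - \<psi> (a + c) (a + c) (a + c) b - \<psi> (a + d) (a + d) (a + d) b - \<psi> (c + d) (c + d) (c + d) b
      + \<psi> a a a b + \<psi> c c c b + \<psi> d d d b"
    unfolding add by (simp add: perm algebra_simps)
  then have "?p + ?p + ?p + ?p + ?p + ?p = 0" by (simp only: diag) simp
  moreover have "s 6 ?p = s (1 + 1 + 1 + 1 + 1 + 1) ?p" by simp
  then have "s 6 ?p = ?p + ?p + ?p + ?p + ?p + ?p"
    unfolding scale_left_distrib scale_one .
  ultimately show ?thesis by simp
qed

lemma jordan_defect_eq_0:
  fixes s :: "'k::field_char_0 \<Rightarrow> 'v::ab_group_add \<Rightarrow> 'v"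
  assumes vs: "vector_space s" and jp: "jordan_product s \<mu>"
  shows "jordan_defect \<mu> a c d b = 0"
proof -
  have mu: "\<mu> \<in> cochain2 s" and jordan: "\<And>x y. \<mu> (\<mu> (\<mu> x x) y) x = \<mu> (\<mu> x x) (\<mu> y x)"
    using jp unfolding jordan_product_def by blast+
  have polar: "jordan_defect \<mu> = polar_defect \<mu> \<mu> \<mu>"
    by (intro ext) (simp add: jordan_defect_def polar_defect_def)
  have "jordan_defect \<mu> \<in> cochain3 s"
    unfolding polar by (rule polar_defect_mem[OF vs mu mu mu])
  \<comment> \<open>For equal symmetric arguments the defect is three times the difference of the
    two sides of the Jordan identity.\<close>
  moreover have "jordan_defect \<mu> x x x y = 0" for x y
    unfolding jordan_defect_def jordan by simp
  ultimately show ?thesis by (rule cochain3_eq_0_if_diagonal_eq_0[OF vs])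
qed

lemma lin_jordan_diff_eq:
  fixes s :: "'k::field_char_0 \<Rightarrow> 'v::ab_group_add \<Rightarrow> 'v"
  assumes "vector_space s" "\<mu> \<in> cochain2 s" "\<phi> \<in> cochain2 s"
  shows "lin_jordan_diff s \<mu> \<phi> = (\<lambda>a c d b.
    polar_defect \<phi> \<mu> \<mu> a c d b + polar_defect \<mu> \<phi> \<mu> a c d b + polar_defect \<mu> \<mu> \<phi> a c d b)"
  using ex1_linear_coeff[OF assms] is_linear_coeff_lin_jordan_diff[OF assms]
    is_linear_coeff_explicit[OF assms] by blast

text \<open>Replacing each \<mu> in turn by \<open>equiv_diff \<mu> D\<close> telescopes:
  \<open>D\<close> applied to the value of an inner product cancels against \<open>D\<close> acting
  on that argument of the enclosing product. Only \<open>D\<close> on the final value and on the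
  four inputs survives.\<close>

lemma lin_jordan_diff_equiv_diff:
  fixes s :: "'k::field_char_0 \<Rightarrow> 'v::ab_group_add \<Rightarrow> 'v"
  assumes vs: "vector_space s" and mu: "\<mu> \<in> cochain2 s" and D: "D \<in> cochain1 s"
  shows "lin_jordan_diff s \<mu> (equiv_diff \<mu> D) a c d b =
    D (jordan_defect \<mu> a c d b) - jordan_defect \<mu> (D a) c d b - jordan_defect \<mu> a (D c) d b
    - jordan_defect \<mu> a c (D d) b - jordan_defect \<mu> a c d (D b)"
proof -
  have "additive D"
    using D unfolding cochain1_def mem_Collect_eq linear_iff_add_scale[OF vs]
    by (simp add: additive.intro)
  note D_simps = additive.add[OF this] additive.diff[OF this]
  \<comment> \<open>Substituting \<open>equiv_diff\<close> puts differences inside \<mu>, so rules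
    for subtraction in each argument are required.\<close>
  have left: "additive (\<lambda>x. \<mu> x y)" and right: "additive (\<mu> y)" for y
    by (simp_all add: additive.intro cochain2D[OF vs mu])
  note mu_simps = cochain2D(2,3)[OF vs mu] additive.diff[OF left] additive.diff[OF right]
  show ?thesis
    unfolding lin_jordan_diff_eq[OF vs mu equiv_diff_mem[OF vs mu D]]
      polar_defect_def jordan_defect_def equiv_diff_def
    by (simp add: D_simps mu_simps algebra_simps)
qed

theorem lemma2p1:
  fixes s :: "'k::field_char_0 \<Rightarrow> 'v::ab_group_add \<Rightarrow> 'v"
    and \<mu> :: "'v \<Rightarrow> 'v \<Rightarrow> 'v"
  assumes "vector_space s"
    and "jordan_product s \<mu>"
  shows "\<forall>D \<in> cochain1 s. lin_jordan_diff s \<mu> (equiv_diff \<mu> D) = (\<lambda>a c d b. 0)"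
proof (intro ballI ext)
  fix D a c d b
  assume D: "D \<in> cochain1 s"
  have mu: "\<mu> \<in> cochain2 s" using assms(2) unfolding jordan_product_def by blast
  have "D (0 + 0) = D 0 + D 0"
    using D unfolding cochain1_def mem_Collect_eq linear_iff_add_scale[OF assms(1)] by blast
  then have "D 0 = 0" by simp
  then show "lin_jordan_diff s \<mu> (equiv_diff \<mu> D) a c d b = 0"
    unfolding lin_jordan_diff_equiv_diff[OF assms(1) mu D] jordan_defect_eq_0[OF assms] by simp
qed

end
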